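(* Let $X$ and $Y$ be normed lattices with the norm on $Y$ strictly convex. If $T\colon X\to Y$ is a positive isometry, then $T-T(0)$ is a lattice homomorphism.
   Context: All vector spaces are real and nontrivial. Maps, including isometries, are not assumed linear, affine, or surjective unless stated; "linear" means $\mathbb{R}$-linear. A *vector lattice* is a vector space with a partial order compatible with the linear structure ($x\le y$ implies $x+z\le y+z$ and $ax\le ay$ for real $a\ge 0$) in which every pair $x,y$ has a supremum $x\vee y$ and an infimum $x\wedge y$. Put $|x|:=x\vee(-x)$, $x^+:=x\vee 0$, $x^-:=(-x)\vee 0$, and $X_+:=\{x\in X: x\ge 0\}$. The five lattice operations are $|x|$, $x\wedge y$, $x\vee y$, $x^+$, $x^-$. A *normed lattice* is a vector lattice with a norm satisfying $|x|\le|y|\Rightarrow\|x\|\le\|y\|$ (completeness is not assumed). A norm on $Y$ is *strictly convex* if $\|x\|=\|y\|=\left\|\frac{x+y}{2}\right\|$ implies $x=y$ for all $x,y\in Y$. A map $T\colon X\to Y$ between normed spaces is an *isometry* if $\|T(x)-T(y)\|_Y=\|x-y\|_X$ for all $x,y\in X$. A map $T\colon X\to Y$ between vector lattices is *positive* if $T(X_+)\subseteq Y_+$. A *lattice homomorphism* is a linear map between vector lattices preserving all five lattice operations. The map $T-T(0)$ is $x\mapsto T(x)-T(0)$. *)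

theory Defs
  imports Complex_Main "HOL-Library.Lattice_Algebras"
begin

class vector_lattice = ordered_real_vector + lattice_ab_group_add_abs

class normed_lattice = real_normed_vector + vector_lattice +
  assumes norm_abs_mono: "\<bar>x\<bar> \<le> \<bar>y\<bar> \<Longrightarrow> norm x \<le> norm y"

(* The library has pprt x = sup x 0 for the positive part, but its nprt x = inf x 0 is the
   negative of the customary negative part. *)
definition neg_part :: "'a::vector_lattice \<Rightarrow> 'a" where
  "neg_part x = sup (- x) 0"

definition strictly_convex_norm :: "'a::real_normed_vector itself \<Rightarrow> bool" where
  "strictly_convex_norm _ \<longleftrightarrow>
     (\<forall>x y :: 'a. norm x = norm y \<and> norm y = norm ((1/2) *\<^sub>R (x + y)) \<longrightarrow> x = y)"

definition isometry :: "('a::real_normed_vector \<Rightarrow> 'b::real_normed_vector) \<Rightarrow> bool" where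
  "isometry T \<longleftrightarrow> (\<forall>x y. norm (T x - T y) = norm (x - y))"

definition positive_map :: "('a::vector_lattice \<Rightarrow> 'b::vector_lattice) \<Rightarrow> bool" where
  "positive_map T \<longleftrightarrow> T ` {x. 0 \<le> x} \<subseteq> {y. 0 \<le> y}"

definition lattice_homomorphism :: "('a::vector_lattice \<Rightarrow> 'b::vector_lattice) \<Rightarrow> bool" where
  "lattice_homomorphism T \<longleftrightarrow>
     linear T \<and>
     (\<forall>x. T \<bar>x\<bar> = \<bar>T x\<bar>) \<and>
     (\<forall>x y. T (inf x y) = inf (T x) (T y)) \<and>
     (\<forall>x y. T (sup x y) = sup (T x) (T y)) \<and>
     (\<forall>x. T (pprt x) = pprt (T x)) \<and>
     (\<forall>x. T (neg_part x) = neg_part (T x))"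

end

theory Submission
  imports Defs
begin

text \<open>
  Strict convexity makes metric midpoints in the target unique, so the isometry is affine and its
  translate \<open>S x = T x - T 0\<close> is a linear isometry. Positivity of \<open>T\<close> along the ray through
  \<open>x \<ge> 0\<close> gives \<open>- T 0 \<le> n S x\<close> for all \<open>n\<close>, so \<open>S\<close> is positive by the Archimedean property. Then
  \<open>\<bar>S x\<bar> \<le> S \<bar>x\<bar>\<close> have equal norms, and strict convexity forces them to coincide.
\<close>

text \<open>Archimedean property of the reals. It serves twice: for the homogeneity of additive maps
  and for the order argument in normed lattices.\<close>

lemma eq_zero_if_norm_multiples_bounded:
  fixes y :: "'b::real_normed_vector"
  assumes "\<And>n::nat. real n * norm y \<le> C"
  shows "y = 0"
proof (rule ccontr)
  assume "y \<noteq> 0"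
  then obtain n where "C < real n * norm y"
    using reals_Archimedean3[of "norm y"] by auto
  with assms[of n] show False by simp
qed

lemma additive_real_of_int:
  fixes f :: "real \<Rightarrow> 'b::real_vector"
  assumes "additive f"
  shows "f (of_int k * a) = of_int k *\<^sub>R f a"
proof -
  interpret additive f by fact
  have nat: "f (real n * a) = real n *\<^sub>R f a" for n
    by (induction n) (simp_all add: zero add algebra_simps)
  show ?thesis
    by (cases k rule: int_cases2) (simp_all add: nat minus)
qed

text \<open>Multiply the defect at \<open>a\<close> by \<open>n\<close>: it equals the defect at the fractional part of \<open>n a\<close>,
  which is bounded.\<close>

lemma additive_real_bounded:
  fixes f :: "real \<Rightarrow> 'b::real_normed_vector"
  assumes "additive f" and bound: "\<And>a. norm (f a) \<le> K * \<bar>a\<bar>"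
  shows "f a = a *\<^sub>R f 1"
proof -
  interpret additive f by fact
  have K: "0 \<le> K" using bound[of 1] norm_ge_zero[of "f 1"] by linarith
  have "f a - a *\<^sub>R f 1 = 0"
  proof (rule eq_zero_if_norm_multiples_bounded)
    fix n :: nat
    let ?r = "frac (real n * a)"
    have "real n *\<^sub>R f a = f (real n * a)"
      using additive_real_of_int[OF assms(1), of "int n" a] by simp
    also have "real n * a = of_int \<lfloor>real n * a\<rfloor> * 1 + ?r"
      by (simp add: frac_def)
    also have "f \<dots> = of_int \<lfloor>real n * a\<rfloor> *\<^sub>R f 1 + f ?r"
      using additive_real_of_int[OF assms(1), of _ 1] by (simp only: add)
    finally have "real n *\<^sub>R (f a - a *\<^sub>R f 1) = f ?r - ?r *\<^sub>R f 1"
      by (simp add: frac_def algebra_simps)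
    then have "real n * norm (f a - a *\<^sub>R f 1) = norm (f ?r - ?r *\<^sub>R f 1)"
      by (metis norm_scaleR abs_of_nat)
    also have "\<dots> \<le> norm (f ?r) + ?r * norm (f 1)"
      by (rule order_trans[OF norm_triangle_ineq4]) simp
    also have "\<dots> \<le> K * 1 + 1 * K"
    proof (intro add_mono mult_mono)
      show "norm (f ?r) \<le> K * 1"
        using bound[of ?r] mult_left_mono[OF less_imp_le[OF frac_lt_1] K, of "real n * a"] by simp
      show "norm (f 1) \<le> K" using bound[of 1] by simp
    qed (auto simp: less_imp_le[OF frac_lt_1])
    finally show "real n * norm (f a - a *\<^sub>R f 1) \<le> K * 1 + 1 * K" .
  qed
  then show ?thesis by simp
qed

text \<open>Homogeneity concerns one line at a time: on the multiples of a fixed \<open>x\<close>,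
  \<open>f\<close> is a bounded additive function of a real variable.\<close>

lemma additive_bounded_imp_linear:
  fixes f :: "'a::real_normed_vector \<Rightarrow> 'b::real_normed_vector"
  assumes "additive f" and bound: "\<And>x. norm (f x) \<le> K * norm x"
  shows "linear f"
proof -
  interpret additive f by fact
  show ?thesis
  proof (rule linearI)
    fix r :: real and x
    have "additive (\<lambda>a. f (a *\<^sub>R x))"
      by unfold_locales (simp add: scaleR_add_left add)
    from additive_real_bounded[OF this, of "K * norm x" r]
    show "f (r *\<^sub>R x) = r *\<^sub>R f x"
      using bound[of "_ *\<^sub>R x"] by (simp add: mult_ac)
  qed (rule add)
qed

text \<open>With \<open>m\<close> the midpoint of \<open>x\<close> and \<open>y\<close>, the vectors
  \<open>T x - T m\<close> and \<open>T m - T y\<close> and their average all have norm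
  \<open>norm (x - y) / 2\<close>, so strict convexity makes the two vectors equal.\<close>

lemma strictly_convex_isometry_midpoint:
  fixes T :: "'a::real_normed_vector \<Rightarrow> 'b::real_normed_vector"
  assumes sc: "strictly_convex_norm TYPE('b)" and iso: "isometry T"
  shows "T ((1/2) *\<^sub>R (x + y)) = (1/2) *\<^sub>R (T x + T y)"
proof -
  let ?m = "(1/2) *\<^sub>R (x + y)"
  have dist: "norm (T u - T v) = norm (u - v)" for u v
    using iso by (simp add: isometry_def)
  have "x - ?m = (1/2) *\<^sub>R (x - y)" "?m - y = (1/2) *\<^sub>R (x - y)"
    by (simp_all add: algebra_simps flip: scaleR_add_left)
  then have "norm (T x - T ?m) = norm (x - y) / 2" "norm (T ?m - T y) = norm (x - y) / 2"
    by (simp_all add: dist)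
  \<comment> \<open>The sum telescopes to \<open>T x - T y\<close>, whose norm is known from the
    isometry.\<close>
  moreover have "norm ((1/2) *\<^sub>R ((T x - T ?m) + (T ?m - T y))) = norm (x - y) / 2"
    by (simp add: dist)
  ultimately have "T x - T ?m = T ?m - T y"
    using sc unfolding strictly_convex_norm_def by presburger
  then have "T x + T y = 2 *\<^sub>R T ?m"
    by (simp add: scaleR_2 algebra_simps)
  then show ?thesis by simp
qed

lemma strictly_convex_isometry_linear:
  fixes T :: "'a::real_normed_vector \<Rightarrow> 'b::real_normed_vector"
  assumes sc: "strictly_convex_norm TYPE('b)" and iso: "isometry T"
  shows "linear (\<lambda>x. T x - T 0)"
proof (rule additive_bounded_imp_linear)
  note mid = strictly_convex_isometry_midpoint[OF sc iso]
  show "additive (\<lambda>x. T x - T 0)"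
  proof
    fix x y
    have "T x + T y = 2 *\<^sub>R T ((1/2) *\<^sub>R (x + y))"
      by (simp add: mid)
    \<comment> \<open>The midpoint of \<open>x\<close> and \<open>y\<close> is also the midpoint of
      \<open>x + y\<close> and \<open>0\<close>.\<close>
    also have "\<dots> = T (x + y) + T 0"
      using mid[of "x + y" 0] by simp
    finally show "T (x + y) - T 0 = T x - T 0 + (T y - T 0)"
      by (simp add: algebra_simps)
  qed
  show "norm (T x - T 0) \<le> 1 * norm x" for x
    using iso by (simp add: isometry_def)
qed

lemma norm_abs_eq:
  fixes x :: "'a::normed_lattice"
  shows "norm \<bar>x\<bar> = norm x"
  by (intro antisym norm_abs_mono) simp_all

lemma norm_mono_nonneg:
  fixes x y :: "'a::normed_lattice"
  assumes "0 \<le> x" "x \<le> y"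
  shows "norm x \<le> norm y"
  using assms by (intro norm_abs_mono) (simp add: order_trans[OF assms])

text \<open>Dividing by \<open>n > 0\<close> traps the negative part of \<open>y\<close> between
  \<open>0\<close> and \<open>z / n\<close>; monotonicity of the norm then forces it to
  vanish.\<close>

lemma normed_lattice_archimedean:
  fixes y z :: "'a::normed_lattice"
  assumes "\<And>n::nat. - z \<le> real n *\<^sub>R y"
  shows "0 \<le> y"
proof -
  \<comment> \<open>The case \<open>n = 0\<close> of the assumption supplies the sign of
    \<open>z\<close>.\<close>
  have z: "0 \<le> z" using assms[of 0] by simp
  have "sup (- y) 0 = 0"
  proof (rule eq_zero_if_norm_multiples_bounded)
    fix n :: nat
    show "real n * norm (sup (- y) 0) \<le> norm z"
    proof (cases "n = 0")
      case False
      have "- y \<le> inverse (real n) *\<^sub>R z"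
        using scaleR_left_mono[OF assms[of n], of "inverse (real n)"] False
        by (simp add: minus_le_iff)
      moreover have "0 \<le> inverse (real n) *\<^sub>R z"
        using z by (simp add: scaleR_nonneg_nonneg)
      ultimately have "norm (sup (- y) 0) \<le> norm (inverse (real n) *\<^sub>R z)"
        by (intro norm_mono_nonneg) simp_all
      then show ?thesis using False by (simp add: field_simps)
    qed simp
  qed
  then have "- y \<le> 0" by (metis sup.cobounded1)
  then show ?thesis by simp
qed

text \<open>The midpoint of \<open>u\<close> and \<open>v\<close> lies between them in the order, so
  its norm is squeezed to the common value and strict convexity applies.\<close>

lemma strictly_convex_norm_mono_eq:
  fixes u v :: "'a::normed_lattice"
  assumes sc: "strictly_convex_norm TYPE('a)"
    and "0 \<le> u" "u \<le> v" "norm u = norm v"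
  shows "u = v"
proof -
  let ?m = "(1/2) *\<^sub>R (u + v)"
  \<comment> \<open>This reads \<open>u\<close> and \<open>v\<close> as \<open>(u + u) / 2\<close>
    and \<open>(v + v) / 2\<close>, to be compared with \<open>(u + v) / 2\<close>.\<close>
  have half: "(1/2) *\<^sub>R (w + w) = w" for w :: 'a
    by (simp flip: scaleR_2)
  have "u \<le> ?m" "?m \<le> v"
    using scaleR_left_mono[OF add_left_mono[OF assms(3)], of "1/2" u]
      scaleR_left_mono[OF add_right_mono[OF assms(3)], of "1/2" v]
    by (simp_all only: half)
  then have "norm u \<le> norm ?m" "norm ?m \<le> norm v"
    using assms(2) order_trans[OF assms(2)] by (blast intro: norm_mono_nonneg)+
  then show ?thesis
    using sc assms(4) unfolding strictly_convex_norm_def by (metis antisym)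
qed

lemma pprt_eq_half_abs:
  fixes x :: "'a::vector_lattice"
  shows "pprt x = (1/2) *\<^sub>R (x + \<bar>x\<bar>)"
proof -
  have "x + \<bar>x\<bar> = 2 *\<^sub>R pprt x"
    using arg_cong2[OF prts abs_prts, of "(+)" x x] by (simp add: scaleR_2)
  then show ?thesis by simp
qed

text \<open>Every lattice operation is built from the absolute value and the linear structure: first
  the positive part, from it \<open>sup\<close> by translation, then \<open>inf\<close> by
  negation.\<close>

lemma linear_abs_imp_lattice_homomorphism:
  fixes S :: "'a::vector_lattice \<Rightarrow> 'b::vector_lattice"
  assumes lin: "linear S" and abs: "\<And>x. S \<bar>x\<bar> = \<bar>S x\<bar>"
  shows "lattice_homomorphism S"
proof -
  have pprt: "S (pprt x) = pprt (S x)" for x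
    by (simp add: pprt_eq_half_abs linear_scale[OF lin] linear_add[OF lin] abs)
  \<comment> \<open>The fresh type \<open>'c\<close> lets the identity be used in both the domain
    and the codomain of \<open>S\<close>.\<close>
  have sup_pprt: "sup x y = y + pprt (x - y)" for x y :: "'c::vector_lattice"
    by (simp add: pprt_def add_sup_distrib_left)
  have sup: "S (sup x y) = sup (S x) (S y)" for x y
    by (simp add: sup_pprt linear_add[OF lin] linear_diff[OF lin] pprt)
  have inf: "S (inf x y) = inf (S x) (S y)" for x y
    by (simp only: inf_eq_neg_sup linear_neg[OF lin] sup)
  have "S (neg_part x) = neg_part (S x)" for x
    by (simp add: neg_part_def sup linear_neg[OF lin] linear_0[OF lin])
  with lin abs sup inf pprt show ?thesis
    by (simp add: lattice_homomorphism_def)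
qed

theorem proposition1p4:
  fixes T :: "'a::normed_lattice \<Rightarrow> 'b::normed_lattice"
  assumes "\<exists>x::'a. x \<noteq> 0"
    and "\<exists>y::'b. y \<noteq> 0"
    and "strictly_convex_norm TYPE('b)"
    and "positive_map T"
    and "isometry T"
  shows "lattice_homomorphism (\<lambda>x. T x - T 0)"
proof -
  define S where "S = (\<lambda>x. T x - T 0)"
  have lin: "linear S"
    unfolding S_def using assms(3,5) by (rule strictly_convex_isometry_linear)
  have norm_S: "norm (S x) = norm x" for x
    using assms(5) by (simp add: isometry_def S_def)
  have S_nonneg: "0 \<le> S x" if "0 \<le> x" for x
  proof (rule normed_lattice_archimedean)
    fix n :: nat
    have "0 \<le> T (real n *\<^sub>R x)"
      using assms(4) that by (simp add: positive_map_def image_subset_iff scaleR_nonneg_nonneg)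
    also have "\<dots> = real n *\<^sub>R S x + T 0"
      using linear_scale[OF lin, of "real n" x] by (simp add: S_def algebra_simps)
    finally show "- T 0 \<le> real n *\<^sub>R S x"
      by (metis diff_ge_0_iff_ge diff_minus_eq_add)
  qed
  have mono: "S x \<le> S y" if "x \<le> y" for x y
    using S_nonneg[of "y - x"] that by (simp add: linear_diff[OF lin])
  have "\<bar>S x\<bar> = S \<bar>x\<bar>" for x
  proof (rule strictly_convex_norm_mono_eq[OF assms(3)])
    show "\<bar>S x\<bar> \<le> S \<bar>x\<bar>"
      \<comment> \<open>Both \<open>x\<close> and \<open>- x\<close> lie below their absolute value,
        and \<open>S (- x) = - S x\<close>.\<close>
      using mono[of x "\<bar>x\<bar>"] mono[of "- x" "\<bar>x\<bar>"]
      by (simp add: linear_neg[OF lin] abs_leI abs_ge_self abs_ge_minus_self)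
    \<comment> \<open>Both sides equal \<open>norm x\<close>, because \<open>S\<close> and the
      absolute value each preserve norms.\<close>
    show "norm \<bar>S x\<bar> = norm (S \<bar>x\<bar>)"
      by (simp add: norm_abs_eq norm_S)
  qed simp
  then have "lattice_homomorphism S"
    by (intro linear_abs_imp_lattice_homomorphism lin) simp
  then show ?thesis by (simp add: S_def)
qed

end
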